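(* Let $U$ and $V$ be two open connected sets, or two convex bodies, in $\mathbb{R}^n$. Let $\varphi:V\to U$ and $h:V\to\mathbb{R}$ be maps such that $Tf=h\cdot (f\circ\varphi)$ defines a bijective weighted composition operator $T:\mathrm{Lip}^{\mathrm{loc}}(U)\to\mathrm{Lip}^{\mathrm{loc}}(V)$ preserving local Lipschitz constants (resp. $T:\mathrm{Lip}^{\mathrm{pt}}(U)\to\mathrm{Lip}^{\mathrm{pt}}(V)$ preserving pointwise Lipschitz constants). Then there is $\alpha>0$ such that $h$ is constant on $V$ with value $\alpha^{-1}$ or $-\alpha^{-1}$, and there are an $n\times n$ orthogonal matrix $A$ and a point $b\in\mathbb{R}^n$ such that $\varphi(v)=\alpha Av+b$ for all $v\in V$.
   Context: $\mathbb{R}^n$ carries the Euclidean norm, and subsets carry the induced metric. For a metric space $(X,d_X)$, $f:X\to\mathbb{R}$ and $p\in X$, set $$L^{\mathrm{loc}}_p(f)=\lim_{\epsilon\to0^+}\sup_{x\neq y\in B(p,\epsilon)}\frac{|f(x)-f(y)|}{d_X(x,y)},\qquad L^{\mathrm{pt}}_p(f)=\limsup_{x\to p}\frac{|f(x)-f(p)|}{d_X(x,p)},$$ where $B(p,\epsilon)$ is the open ball in $X$ with center $p$ and radius $\epsilon$. $\mathrm{Lip}(X)$ is the space of Lipschitz functions $f:X\to\mathbb{R}$; $\mathrm{Lip}^{\mathrm{loc}}(X)$ (resp. $\mathrm{Lip}^{\mathrm{pt}}(X)$) is the real vector space of all $f:X\to\mathbb{R}$ with $L^{\mathrm{loc}}_p(f)<+\infty$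 (resp. $L^{\mathrm{pt}}_p(f)<+\infty$) for all $p\in X$. A weighted composition operator $Tf=h\cdot (f\circ\varphi)$ from $\mathrm{Lip}^{\mathrm{loc}}(X)$ into $\mathrm{Lip}^{\mathrm{loc}}(Y)$ (resp. from $\mathrm{Lip}^{\mathrm{pt}}(X)$ into $\mathrm{Lip}^{\mathrm{pt}}(Y)$) preserves local (resp. pointwise) Lipschitz constants if $L^{\mathrm{loc}}_p(Tf)=L^{\mathrm{loc}}_{\varphi(p)}(f)$ (resp. $L^{\mathrm{pt}}_p(Tf)=L^{\mathrm{pt}}_{\varphi(p)}(f)$) for all $f\in\mathrm{Lip}(X)$ and all $p\in Y$. A convex body is a (not necessarily closed or bounded) convex set with nonempty interior. *)

theory Defs
  imports "HOL-Analysis.Analysis"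
begin

text \<open>
  A metric space is a subset \<open>X\<close> of a metric type with the induced metric, and a function
  \<open>X \<rightarrow> \<real>\<close> is an element of \<open>extensional X\<close>, so that two functions on \<open>X\<close> are equal iff they
  agree on \<open>X\<close>. The (local and pointwise) Lipschitz constants take values in \<open>[0, \<infinity>]\<close>;
  at an isolated point both are 0, since the supremum of the empty set in \<^typ>\<open>ennreal\<close> is 0.
\<close>

definition sup_quotient :: "'a::metric_space set \<Rightarrow> ('a \<Rightarrow> real) \<Rightarrow> 'a \<Rightarrow> real \<Rightarrow> ennreal" where
  "sup_quotient X f p \<epsilon> =
     (SUP (x, y) \<in> {(x, y). x \<in> X \<inter> ball p \<epsilon> \<and> y \<in> X \<inter> ball p \<epsilon> \<and> x \<noteq> y}.
        ennreal (\<bar>f x - f y\<bar> / dist x y))"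

definition L_loc :: "'a::metric_space set \<Rightarrow> ('a \<Rightarrow> real) \<Rightarrow> 'a \<Rightarrow> ennreal" where
  "L_loc X f p = Lim (at_right 0) (sup_quotient X f p)"

definition L_pt :: "'a::metric_space set \<Rightarrow> ('a \<Rightarrow> real) \<Rightarrow> 'a \<Rightarrow> ennreal" where
  "L_pt X f p = Limsup (at p within X) (\<lambda>x. ennreal (\<bar>f x - f p\<bar> / dist x p))"

text \<open>The limit defining \<^const>\<open>L_loc\<close> always exists, by monotonicity in \<open>\<epsilon>\<close>.\<close>

lemma sup_quotient_mono: "\<epsilon> \<le> \<delta> \<Longrightarrow> sup_quotient X f p \<epsilon> \<le> sup_quotient X f p \<delta>"
  unfolding sup_quotient_def by (rule SUP_subset_mono) auto

lemma sup_quotient_tendsto_INF: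
  "(sup_quotient X f p \<longlongrightarrow> (INF \<epsilon>\<in>{0<..}. sup_quotient X f p \<epsilon>)) (at_right 0)"
proof (rule order_tendstoI)
  fix a assume a: "a < (INF \<epsilon>\<in>{0<..}. sup_quotient X f p \<epsilon>)"
  have "a < sup_quotient X f p \<epsilon>" if "\<epsilon> > 0" for \<epsilon>
    using that by (intro less_le_trans[OF a] INF_lower) auto
  then show "\<forall>\<^sub>F \<epsilon> in at_right 0. a < sup_quotient X f p \<epsilon>"
    by (auto simp: eventually_at_right_field intro: exI[of _ 1])
next
  fix a assume "(INF \<epsilon>\<in>{0<..}. sup_quotient X f p \<epsilon>) < a"
  then obtain \<delta> :: real where \<delta>: "\<delta> > 0" "sup_quotient X f p \<delta> < a"
    by (auto simp: INF_less_iff)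
  have "sup_quotient X f p \<epsilon> < a" if "\<epsilon> < \<delta>" for \<epsilon>
    using sup_quotient_mono[of \<epsilon> \<delta> X f p] that \<delta>(2) by (auto intro: le_less_trans)
  then show "\<forall>\<^sub>F \<epsilon> in at_right 0. sup_quotient X f p \<epsilon> < a"
    using \<delta>(1) by (auto simp: eventually_at_right_field)
qed

lemma L_loc_tendsto: "(sup_quotient X f p \<longlongrightarrow> L_loc X f p) (at_right 0)"
  unfolding L_loc_def
  using sup_quotient_tendsto_INF[of X f p]
  by (simp add: tendsto_Lim[OF trivial_limit_at_right_real sup_quotient_tendsto_INF])

definition Lip :: "'a::metric_space set \<Rightarrow> ('a \<Rightarrow> real) set" where
  "Lip X = {f \<in> extensional X. \<exists>C. C-lipschitz_on X f}"

definition Lip_loc :: "'a::metric_space set \<Rightarrow> ('a \<Rightarrow> real) set" where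
  "Lip_loc X = {f \<in> extensional X. \<forall>p\<in>X. L_loc X f p < \<infinity>}"

definition Lip_pt :: "'a::metric_space set \<Rightarrow> ('a \<Rightarrow> real) set" where
  "Lip_pt X = {f \<in> extensional X. \<forall>p\<in>X. L_pt X f p < \<infinity>}"

definition weighted_comp ::
    "'b set \<Rightarrow> ('b \<Rightarrow> real) \<Rightarrow> ('b \<Rightarrow> 'a) \<Rightarrow> ('a \<Rightarrow> real) \<Rightarrow> ('b \<Rightarrow> real)" where
  "weighted_comp Y h \<phi> f = (\<lambda>y\<in>Y. h y * f (\<phi> y))"

definition preserves_local_constants ::
    "'a::metric_space set \<Rightarrow> 'b::metric_space set \<Rightarrow> ('b \<Rightarrow> 'a) \<Rightarrow>
     (('a \<Rightarrow> real) \<Rightarrow> ('b \<Rightarrow> real)) \<Rightarrow> bool" where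
  "preserves_local_constants X Y \<phi> T \<longleftrightarrow>
     (\<forall>f\<in>Lip X. \<forall>p\<in>Y. L_loc Y (T f) p = L_loc X f (\<phi> p))"

definition preserves_pointwise_constants ::
    "'a::metric_space set \<Rightarrow> 'b::metric_space set \<Rightarrow> ('b \<Rightarrow> 'a) \<Rightarrow>
     (('a \<Rightarrow> real) \<Rightarrow> ('b \<Rightarrow> real)) \<Rightarrow> bool" where
  "preserves_pointwise_constants X Y \<phi> T \<longleftrightarrow>
     (\<forall>f\<in>Lip X. \<forall>p\<in>Y. L_pt Y (T f) p = L_pt X f (\<phi> p))"

definition convex_body :: "'a::real_normed_vector set \<Rightarrow> bool" where
  "convex_body S \<longleftrightarrow> convex S \<and> interior S \<noteq> {}"

end

theory Submission imports Defs begin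

text \<open>
  Applying the operator to the constant 1 shows that \<open>h\<close> has derivative 0, so it is a constant \<open>c\<close>.
  Bijectivity makes \<open>\<phi>\<close> a homeomorphism whose inverse \<open>\<psi>\<close> has finite pointwise Lipschitz
  constants. Testing with distance functions, the pointwise constant of \<open>\<phi>\<close> is at most \<open>1 / \<bar>c\<bar>\<close>
  everywhere, and that of \<open>\<psi>\<close> is at most \<open>\<bar>c\<bar>\<close> at every point near which \<open>\<psi>\<close> is Lipschitz; by a
  Baire category argument this covers the whole interior. Pointwise bounds integrate along segments,
  so \<open>\<phi>\<close> is locally a similarity of ratio \<open>1 / \<bar>c\<bar>\<close> on the interior of \<open>V\<close>, hence affine there,
  and by density on all of \<open>V\<close>. Only inequalities between the pointwise constant, the given constant
  and the Lipschitz constant on neighbourhoods are used, so both cases are treated at once.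
\<close>

subsection \<open>Pointwise Lipschitz bounds\<close>

text \<open>Encodes that the pointwise constant at \<open>p\<close> is at most \<open>C\<close>, for
  maps into any metric space. The slack \<open>\<epsilon>\<close> is what a limsup bound yields, as
  the estimate with \<open>C\<close> itself may fail at every scale.\<close>

definition pointwise_lipschitz ::
    "real \<Rightarrow> 'a::metric_space set \<Rightarrow> ('a \<Rightarrow> 'b::metric_space) \<Rightarrow> 'a \<Rightarrow> bool" where
  "pointwise_lipschitz C X f p \<longleftrightarrow>
     (\<forall>\<epsilon>>0. \<forall>\<^sub>F x in at p within X. dist (f x) (f p) \<le> (C + \<epsilon>) * dist x p)"

lemma pointwise_lipschitzI:
  assumes "\<forall>\<^sub>F x in at p within X. dist (f x) (f p) \<le> C * dist x p"
  shows "pointwise_lipschitz C X f p"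
  unfolding pointwise_lipschitz_def
proof (intro allI impI)
  fix \<epsilon> :: real assume "\<epsilon> > 0"
  show "\<forall>\<^sub>F x in at p within X. dist (f x) (f p) \<le> (C + \<epsilon>) * dist x p"
    using assms
  proof eventually_elim
    case (elim x)
    moreover have "C * dist x p \<le> (C + \<epsilon>) * dist x p"
      using \<open>\<epsilon> > 0\<close> by (intro mult_right_mono) auto
    ultimately show ?case by linarith
  qed
qed

lemma pointwise_lipschitz_le:
  assumes "pointwise_lipschitz C X f p" "C \<le> D"
  shows "pointwise_lipschitz D X f p"
  unfolding pointwise_lipschitz_def
proof (intro allI impI)
  fix \<epsilon> :: real assume "\<epsilon> > 0"
  with assms(1) have "\<forall>\<^sub>F x in at p within X. dist (f x) (f p) \<le> (C + \<epsilon>) * dist x p"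
    by (simp add: pointwise_lipschitz_def)
  then show "\<forall>\<^sub>F x in at p within X. dist (f x) (f p) \<le> (D + \<epsilon>) * dist x p"
  proof eventually_elim
    case (elim x)
    moreover have "(C + \<epsilon>) * dist x p \<le> (D + \<epsilon>) * dist x p"
      using \<open>C \<le> D\<close> by (intro mult_right_mono) auto
    ultimately show ?case by linarith
  qed
qed

lemma pointwise_lipschitz_subset:
  assumes "pointwise_lipschitz C X f p" "Y \<subseteq> X"
  shows "pointwise_lipschitz C Y f p"
  using assms at_le[of Y X p] unfolding pointwise_lipschitz_def le_filter_def by blast

lemma pointwise_lipschitz_cong:
  assumes "\<And>x. x \<in> X \<Longrightarrow> f x = g x" "p \<in> X"
  shows "pointwise_lipschitz C X f p \<longleftrightarrow> pointwise_lipschitz C X g p"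
  unfolding pointwise_lipschitz_def eventually_at using assms by simp

lemma pointwise_lipschitz_tendsto:
  assumes "pointwise_lipschitz C X f p"
  shows "(f \<longlongrightarrow> f p) (at p within X)"
proof -
  have "\<forall>\<^sub>F x in at p within X. dist (f x) (f p) \<le> (C + 1) * dist x p"
    using assms unfolding pointwise_lipschitz_def by (metis zero_less_one)
  then have "\<forall>\<^sub>F x in at p within X. norm (dist (f x) (f p)) \<le> norm (dist x p) * (C + 1)"
    by (simp add: mult.commute)
  moreover have "((\<lambda>x. dist x p) \<longlongrightarrow> dist p p) (at p within X)"
    by (intro tendsto_dist tendsto_ident_at tendsto_const)
  ultimately have "((\<lambda>x. dist (f x) (f p)) \<longlongrightarrow> 0) (at p within X)"
    using tendsto_0_le[of "\<lambda>x. dist x p" "at p within X" "\<lambda>x. dist (f x) (f p)" "C + 1"] by simp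
  then show ?thesis
    by (rule iffD2[OF tendsto_dist_iff])
qed

lemma pointwise_lipschitz_imp_continuous_on:
  assumes "\<And>p. p \<in> X \<Longrightarrow> \<exists>C. pointwise_lipschitz C X f p"
  shows "continuous_on X f"
  using assms pointwise_lipschitz_tendsto unfolding continuous_on_def by blast

lemma pointwise_lipschitz_0_imp_has_derivative_0:
  fixes f :: "'a::real_normed_vector \<Rightarrow> 'b::real_normed_vector"
  assumes "pointwise_lipschitz 0 X f p"
  shows "(f has_derivative (\<lambda>_. 0)) (at p within X)"
  using assms by (simp add: has_derivative_within_alt2 pointwise_lipschitz_def dist_norm)

text \<open>
  Bolzano's bisection principle along a segment: it suffices that points near \<open>x\<close>, one on
  each side of it, satisfy the estimate, and these are compared with \<open>x\<close> itself.
\<close>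
lemma pointwise_lipschitz_imp_lipschitz_on:
  fixes f :: "'a::real_normed_vector \<Rightarrow> 'b::metric_space"
  assumes "convex S" "C \<ge> 0"
    and pl: "\<And>p. p \<in> S \<Longrightarrow> pointwise_lipschitz C S f p"
  shows "C-lipschitz_on S f"
proof (rule lipschitz_onI)
  fix a b assume ab: "a \<in> S" "b \<in> S"
  define g where "g t = a + t *\<^sub>R (b - a)" for t
  have g: "g t \<in> S" if "t \<in> {0..1}" for t
    using convexD_alt[OF \<open>convex S\<close> ab, of t] that
    by (auto simp: g_def algebra_simps)
  have dist_g: "dist (g s) (g t) = \<bar>s - t\<bar> * dist a b" for s t
  proof -
    have "g s - g t = (s - t) *\<^sub>R (b - a)" by (simp add: g_def algebra_simps)
    then show ?thesis by (simp add: dist_norm norm_minus_commute)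
  qed
  have bound: "dist (f a) (f b) \<le> (C + \<epsilon>) * dist a b" if "\<epsilon> > 0" for \<epsilon>
  proof (cases "a = b")
    case False
    \<comment> \<open>Bolzano's principle also tests parameters outside the unit interval; the guard
      makes \<open>P\<close> vacuous there.\<close>
    define P where "P s t \<longleftrightarrow> (s \<in> {0..1} \<and> t \<in> {0..1} \<and> s \<le> t \<longrightarrow>
        dist (f (g s)) (f (g t)) \<le> (C + \<epsilon>) * ((t - s) * dist a b))" for s t
    have "P 0 1"
    proof (rule Bolzano[where P = P])
      fix r s t assume trans: "P r s" "P s t" "r \<le> s" "s \<le> t"
      show "P r t" unfolding P_def
      proof
        assume "r \<in> {0..1} \<and> t \<in> {0..1} \<and> r \<le> t"
        with trans have "dist (f (g r)) (f (g s)) \<le> (C + \<epsilon>) * ((s - r) * dist a b)"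
          "dist (f (g s)) (f (g t)) \<le> (C + \<epsilon>) * ((t - s) * dist a b)"
          by (auto simp: P_def)
        moreover have "dist (f (g r)) (f (g t)) \<le> dist (f (g r)) (f (g s)) + dist (f (g s)) (f (g t))"
          by (rule dist_triangle)
        ultimately show "dist (f (g r)) (f (g t)) \<le> (C + \<epsilon>) * ((t - r) * dist a b)"
          by (simp add: algebra_simps)
      qed
    next
      fix x :: real assume "0 \<le> x" "x \<le> 1"
      then have "pointwise_lipschitz C S f (g x)" by (intro pl g) auto
      then obtain d where "d > 0" and
        d: "\<And>y. \<lbrakk>y \<in> S; y \<noteq> g x; dist y (g x) < d\<rbrakk> \<Longrightarrow>
              dist (f y) (f (g x)) \<le> (C + \<epsilon>) * dist y (g x)"
        using \<open>\<epsilon> > 0\<close> unfolding pointwise_lipschitz_def eventually_at by metis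
      have near: "dist (f (g t)) (f (g x)) \<le> (C + \<epsilon>) * (\<bar>t - x\<bar> * dist a b)"
        if "t \<in> {0..1}" "\<bar>t - x\<bar> < d / dist a b" for t
      proof (cases "g t = g x")
        case True
        then show ?thesis using \<open>\<epsilon> > 0\<close> \<open>C \<ge> 0\<close> by simp
      next
        case False
        then show ?thesis
          using d[OF g[OF that(1)]] that(2) \<open>a \<noteq> b\<close> by (simp add: dist_g field_simps)
      qed
      have "P s t" if "s \<le> x" "x \<le> t" "t - s < d / dist a b" for s t
        unfolding P_def
      proof
        assume "s \<in> {0..1} \<and> t \<in> {0..1} \<and> s \<le> t"
        then have "dist (f (g s)) (f (g x)) \<le> (C + \<epsilon>) * (\<bar>s - x\<bar> * dist a b)"
          "dist (f (g t)) (f (g x)) \<le> (C + \<epsilon>) * (\<bar>t - x\<bar> * dist a b)"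
          using that by (intro near; simp)+
        moreover have "dist (f (g s)) (f (g t)) \<le> dist (f (g s)) (f (g x)) + dist (f (g t)) (f (g x))"
          by (rule dist_triangle2)
        ultimately show "dist (f (g s)) (f (g t)) \<le> (C + \<epsilon>) * ((t - s) * dist a b)"
          using that by (simp add: algebra_simps)
      qed
      then show "\<exists>e>0. \<forall>s t. s \<le> x \<and> x \<le> t \<and> t - s < e \<longrightarrow> P s t"
        using \<open>d > 0\<close> \<open>a \<noteq> b\<close> by (intro exI[of _ "d / dist a b"]) auto
    qed auto
    then show ?thesis by (simp add: P_def g_def)
  qed auto
  have "dist (f a) (f b) - C * dist a b \<le> \<epsilon> * dist a b" if "\<epsilon> > 0" for \<epsilon>
    using bound[OF that] by (simp add: algebra_simps)
  moreover have "((\<lambda>\<epsilon>. \<epsilon> * dist a b) \<longlongrightarrow> 0 * dist a b) (at_right 0)"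
    by (intro tendsto_intros)
  ultimately have "dist (f a) (f b) - C * dist a b \<le> 0 * dist a b"
    by (intro tendsto_lowerbound[where F = "at_right 0" and f = "\<lambda>\<epsilon>. \<epsilon> * dist a b"])
       (auto simp: eventually_at_right_field intro: exI[of _ 1])
  then show "dist (f a) (f b) \<le> C * dist a b" by simp
qed fact

lemma dist_diff_le: "\<bar>dist x a - dist y a\<bar> \<le> dist x y"
  by (metis abs_dist_diff_le dist_commute)

text \<open>The level set is the trace on \<open>X\<close> of a closed set, which contains
  \<open>S\<close> and hence its closure.\<close>

lemma continuous_constant_on_dense:
  fixes f :: "'a::topological_space \<Rightarrow> 'b::t1_space"
  assumes "continuous_on X f" "S \<subseteq> X" "X \<subseteq> closure S" "\<And>x. x \<in> S \<Longrightarrow> f x = c" "x \<in> X"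
  shows "f x = c"
proof -
  have "closedin (top_of_set X) {x \<in> X. f x = c}"
    by (rule continuous_closedin_preimage_constant) fact
  then obtain T where T: "closed T" "{x \<in> X. f x = c} = X \<inter> T"
    by (auto simp: closedin_closed)
  then have "S \<subseteq> T" using assms(2,4) by auto
  then show ?thesis using T assms(3,5) closure_minimal[of S T] by auto
qed

section \<open>Comparison of the two Lipschitz constants with Lipschitz bounds\<close>

lemma L_pt_le_imp_pointwise_lipschitz:
  assumes "L_pt X f p \<le> ennreal C" "C \<ge> 0"
  shows "pointwise_lipschitz C X f p"
  unfolding pointwise_lipschitz_def
proof (intro allI impI)
  fix \<epsilon> :: real assume "\<epsilon> > 0"
  then have "L_pt X f p < ennreal (C + \<epsilon>)"
    using assms by (auto intro: le_less_trans simp: ennreal_less_iff)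
  then have "\<forall>\<^sub>F x in at p within X. ennreal (\<bar>f x - f p\<bar> / dist x p) < ennreal (C + \<epsilon>)"
    unfolding L_pt_def by (rule Limsup_lessD)
  moreover have "\<forall>\<^sub>F x in at p within X. x \<noteq> p"
    by (simp add: eventually_at_filter)
  ultimately show "\<forall>\<^sub>F x in at p within X. dist (f x) (f p) \<le> (C + \<epsilon>) * dist x p"
  proof eventually_elim
    case (elim x)
    then have "\<bar>f x - f p\<bar> / dist x p < C + \<epsilon>"
      by (simp add: ennreal_less_iff)
    with elim show ?case by (simp add: dist_real_def pos_divide_less_eq)
  qed
qed

lemma L_loc_eq_INF: "L_loc X f p = (INF \<epsilon>\<in>{0<..}. sup_quotient X f p \<epsilon>)"
  by (rule tendsto_unique[OF _ L_loc_tendsto sup_quotient_tendsto_INF]) simp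

text \<open>The supremum over pairs in a ball includes the pairs with second entry \<open>p\<close>,
  and these form the pointwise quotient.\<close>

lemma L_pt_le_L_loc:
  assumes "p \<in> X"
  shows "L_pt X f p \<le> L_loc X f p"
  unfolding L_loc_eq_INF
proof (rule INF_greatest)
  fix \<epsilon> :: real assume "\<epsilon> \<in> {0<..}"
  then have "\<forall>\<^sub>F x in at p within X. x \<in> X \<inter> ball p \<epsilon> \<and> x \<noteq> p"
    unfolding eventually_at by (auto simp: dist_commute)
  then have "\<forall>\<^sub>F x in at p within X.
      ennreal (\<bar>f x - f p\<bar> / dist x p) \<le> sup_quotient X f p \<epsilon>"
  proof eventually_elim
    case (elim x)
    then have "(x, p) \<in> {(x, y). x \<in> X \<inter> ball p \<epsilon> \<and> y \<in> X \<inter> ball p \<epsilon> \<and> x \<noteq> y}"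
      using assms \<open>\<epsilon> \<in> {0<..}\<close> by auto
    then show ?case unfolding sup_quotient_def by (rule SUP_upper2) simp
  qed
  then show "L_pt X f p \<le> sup_quotient X f p \<epsilon>"
    unfolding L_pt_def by (rule Limsup_bounded)
qed

text \<open>The limit is an infimum over radii, so the single radius \<open>r\<close> already bounds
  it.\<close>

lemma L_loc_le_lipschitz:
  assumes "r > 0" "C-lipschitz_on (X \<inter> ball p r) f"
  shows "L_loc X f p \<le> ennreal C"
proof -
  have "L_loc X f p \<le> sup_quotient X f p r"
    unfolding L_loc_eq_INF using \<open>r > 0\<close> by (intro INF_lower) auto
  also have "\<dots> \<le> ennreal C"
    unfolding sup_quotient_def
  proof (rule SUP_least, clarify)
    fix x y assume xy: "x \<in> X" "x \<in> ball p r" "y \<in> X" "y \<in> ball p r" "x \<noteq> y"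
    then have "dist (f x) (f y) \<le> C * dist x y"
      by (intro lipschitz_onD[OF assms(2)]) auto
    then show "ennreal (\<bar>f x - f y\<bar> / dist x y) \<le> ennreal C"
      using \<open>x \<noteq> y\<close> by (intro ennreal_leI) (simp add: dist_real_def divide_le_eq)
  qed
  finally show ?thesis .
qed

text \<open>Preservation is assumed only for functions in \<open>Lip U\<close>, so a test function
  that is Lipschitz near \<open>q\<close> must be made globally Lipschitz. The cone of slope
  \<open>C\<close> reaches 0 at distance \<open>r\<close> from \<open>q\<close>, so the minimum with
  it joins the zero function without increasing the constant.\<close>

lemma lipschitz_on_truncate:
  fixes g :: "'a::metric_space \<Rightarrow> real"
  assumes g: "C-lipschitz_on (X \<inter> ball q r) g" and nonneg: "\<And>x. 0 \<le> g x"
  shows "C-lipschitz_on X (\<lambda>x. if dist x q < r then min (g x) (C * (r - dist x q)) else 0)"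
    (is "_-lipschitz_on _ ?f")
proof (rule lipschitz_onI)
  show C: "0 \<le> C" using g by (rule lipschitz_on_nonneg)
  have one_side: "dist (?f x) (?f y) \<le> C * dist x y"
    if "x \<in> X" "y \<in> X" "dist x q < r" for x y
  proof (cases "dist y q < r")
    case True
    have "\<bar>g x - g y\<bar> \<le> C * dist x y"
      using lipschitz_onD[OF g, of x y] that True by (simp add: dist_commute dist_real_def)
    moreover have "\<bar>C * (r - dist x q) - C * (r - dist y q)\<bar> \<le> C * dist x y"
    proof -
      have "\<bar>dist y q - dist x q\<bar> \<le> dist x y"
        using dist_diff_le[of x q y] by (simp add: abs_minus_commute)
      then have "C * \<bar>dist y q - dist x q\<bar> \<le> C * dist x y"
        using C by (rule mult_left_mono)
      moreover have "C * (r - dist x q) - C * (r - dist y q) = C * (dist y q - dist x q)"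
        by (simp add: algebra_simps)
      ultimately show ?thesis using C by (simp add: abs_mult)
    qed
    ultimately show ?thesis using that True by (simp add: dist_real_def)
  next
    case False
    \<comment> \<open>Leaving the ball costs at least the remaining distance
      \<open>r - dist x q\<close>, so the height of the cone at \<open>x\<close> bounds the jump to
      0.\<close>
    have "r - dist x q \<le> dist x y"
      using False dist_triangle[of y q x] by (simp add: dist_commute)
    then have "C * (r - dist x q) \<le> C * dist x y"
      using C by (rule mult_left_mono)
    moreover have "0 \<le> C * (r - dist x q)" using C that by simp
    ultimately show ?thesis
      using False that nonneg[of x] by (auto simp: dist_real_def min_def)
  qed
  fix x y assume xy: "x \<in> X" "y \<in> X"
  show "dist (?f x) (?f y) \<le> C * dist x y"
    using one_side[OF xy] one_side[OF xy(2,1)] C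
    by (cases "dist x q < r"; cases "dist y q < r") (auto simp: dist_commute)
qed

text \<open>
  The points near which \<open>f\<close> is Lipschitz form an open set \<open>W\<close>. By Baire's theorem, if \<open>S - W\<close>
  were nonempty, the pointwise bound would be uniform on a relatively open part of it; together
  with the bound \<open>K\<close> on \<open>W\<close> this makes \<open>f\<close> Lipschitz near some point of \<open>S - W\<close>.
\<close>
lemma pointwise_lipschitz_Baire:
  fixes f :: "'a::euclidean_space \<Rightarrow> 'b::metric_space"
  assumes "open S" "K \<ge> 0"
    and pl: "\<And>p. p \<in> S \<Longrightarrow> \<exists>C. pointwise_lipschitz C S f p"
    and improve: "\<And>p r C. \<lbrakk>p \<in> S; r > 0; C-lipschitz_on (S \<inter> ball p r) f\<rbrakk>
                    \<Longrightarrow> pointwise_lipschitz K S f p"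
    and "p \<in> S"
  shows "pointwise_lipschitz K S f p"
proof -
  define W where "W = {p \<in> S. \<exists>r>0. \<exists>C. C-lipschitz_on (S \<inter> ball p r) f}"
  have "open W"
    unfolding open_contains_ball
  proof
    fix x assume "x \<in> W"
    then obtain r C where x: "x \<in> S" "r > 0" and C: "C-lipschitz_on (S \<inter> ball x r) f"
      by (auto simp: W_def)
    obtain e where "e > 0" and e: "ball x e \<subseteq> S \<inter> ball x r"
      using \<open>open S\<close> x by (metis IntI centre_in_ball open_Int open_ball open_contains_ball)
    have "ball x e \<subseteq> W"
    proof
      fix y assume y: "y \<in> ball x e"
      then obtain d where "d > 0" "ball y d \<subseteq> ball x e"
        using open_ball open_contains_ball by blast
      then have "C-lipschitz_on (S \<inter> ball y d) f"
        using e by (intro lipschitz_on_subset[OF C]) auto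
      then show "y \<in> W" using y e \<open>d > 0\<close> unfolding W_def by blast
    qed
    then show "\<exists>e>0. ball x e \<subseteq> W" using \<open>e > 0\<close> by blast
  qed
  have W: "pointwise_lipschitz K S f x" if "x \<in> W" for x
    using that improve by (auto simp: W_def)
  have cont: "continuous_on S f"
    using pl by (rule pointwise_lipschitz_imp_continuous_on)
  \<comment> \<open>One number \<open>n\<close> controls both the constant and the scale, giving
    countably many sets; \<open>Suc\<close> keeps the radius meaningful for
    \<open>n = 0\<close>.\<close>
  define E where "E n = {x \<in> S - W. \<forall>y\<in>S. dist y x < 1 / real (Suc n) \<longrightarrow>
      dist (f y) (f x) \<le> real n * dist y x}" for n
  let ?X = "top_of_set (S - W)"
  have "S - W = {}"
  proof (rule ccontr)
    assume ne: "S - W \<noteq> {}"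
    have cm: "completely_metrizable_space ?X"
    proof -
      have "completely_metrizable_space (top_of_set S)"
        using \<open>open S\<close> by (intro completely_metrizable_space_openin
            completely_metrizable_space_euclidean) auto
      moreover have "closedin (top_of_set S) (S - W)"
        using \<open>open W\<close> by (metis Diff_eq closed_Compl closedin_closed_Int)
      ultimately have "completely_metrizable_space (subtopology (top_of_set S) (S - W))"
        by (rule completely_metrizable_space_closedin)
      then show ?thesis by (simp add: subtopology_subtopology Int_absorb1)
    qed
    \<comment> \<open>With \<open>y\<close> fixed, the estimate passes to limits of the centres by
      continuity of \<open>f\<close>. The strict bound on the distance ensures that \<open>y\<close>
      is also in range of the nearby centres.\<close>
    have closed: "closedin ?X (E n)" for n
      unfolding closedin_limpt
    proof (intro conjI allI impI)
      fix x assume x: "x islimpt E n \<and> x \<in> S - W"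
      show "x \<in> E n"
        unfolding E_def
      proof (intro CollectI conjI ballI impI)
        fix y assume y: "y \<in> S" "dist y x < 1 / real (Suc n)"
        have nt: "at x within E n \<noteq> bot"
          using x by (simp add: trivial_limit_within)
        have "((\<lambda>z. dist y z) \<longlongrightarrow> dist y x) (at x within E n)"
          by (intro tendsto_intros)
        then have "\<forall>\<^sub>F z in at x within E n. dist y z < 1 / real (Suc n)"
          using y(2) by (rule order_tendstoD)
        moreover have "\<forall>\<^sub>F z in at x within E n. z \<in> E n"
          by (simp add: eventually_at_filter)
        ultimately have ev: "\<forall>\<^sub>F z in at x within E n. dist (f y) (f z) \<le> real n * dist y z"
          by eventually_elim (use y(1) in \<open>auto simp: E_def\<close>)
        have "(f \<longlongrightarrow> f x) (at x within E n)"
          using cont x continuous_on_subset[OF cont, of "insert x (E n)"]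
          by (auto simp: continuous_on_def E_def intro: tendsto_within_subset)
        then have "((\<lambda>z. dist (f y) (f z)) \<longlongrightarrow> dist (f y) (f x)) (at x within E n)"
          by (intro tendsto_dist tendsto_const)
        moreover have "((\<lambda>z. real n * dist y z) \<longlongrightarrow> real n * dist y x) (at x within E n)"
          by (intro tendsto_intros)
        ultimately show "dist (f y) (f x) \<le> real n * dist y x"
          using nt ev by (intro tendsto_le[of "at x within E n" _ _ "\<lambda>z. dist (f y) (f z)"])
      qed (use x in auto)
    qed (auto simp: E_def)
    have int: "?X interior_of (\<Union>(range E)) \<noteq> {}"
    proof -
      have "x \<in> \<Union>(range E)" if "x \<in> S - W" for x
      proof -
        obtain C where "pointwise_lipschitz C S f x" using pl \<open>x \<in> S - W\<close> by blast
        then have "\<forall>\<^sub>F y in at x within S. dist (f y) (f x) \<le> (C + 1) * dist y x"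
          unfolding pointwise_lipschitz_def by (metis zero_less_one)
        then obtain d where "d > 0"
          and d: "\<And>y. \<lbrakk>y \<in> S; y \<noteq> x; dist y x < d\<rbrakk> \<Longrightarrow> dist (f y) (f x) \<le> (C + 1) * dist y x"
          unfolding eventually_at by blast
        \<comment> \<open>Exceeding \<open>C + 1\<close> takes care of the constant, and exceeding
          \<open>1 / d\<close> makes the radius in \<open>E n\<close> at most
          \<open>d\<close>.\<close>
        obtain n where n: "real n > max (C + 1) (1 / d)"
          using reals_Archimedean2 by blast
        have "1 / real (Suc n) \<le> d"
          using n \<open>d > 0\<close> by (simp add: field_simps)
        have "dist (f y) (f x) \<le> real n * dist y x"
          if "y \<in> S" "dist y x < 1 / real (Suc n)" for y
        proof (cases "y = x")
          case False
          then have "dist (f y) (f x) \<le> (C + 1) * dist y x"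
            using that \<open>1 / real (Suc n) \<le> d\<close> by (intro d) auto
          also have "\<dots> \<le> real n * dist y x"
            using n by (intro mult_right_mono) auto
          finally show ?thesis .
        qed auto
        then show ?thesis using \<open>x \<in> S - W\<close> by (auto simp: E_def)
      qed
      then have "\<Union>(range E) = topspace ?X" by (auto simp: E_def)
      then show ?thesis using ne interior_of_topspace[of ?X] by (metis topspace_euclidean_subtopology)
    qed
    have "\<not> (\<forall>n. ?X interior_of (E n) = {})"
    proof
      assume "\<forall>n. ?X interior_of (E n) = {}"
      with cm closed have "?X interior_of (\<Union>(range E)) = {}"
        by (intro Baire_category_alt) auto
      with int show False by contradiction
    qed
    then obtain n where "?X interior_of (E n) \<noteq> {}"
      by blast
    then obtain x T where T: "openin ?X T" "x \<in> T" "T \<subseteq> E n"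
      unfolding interior_of_def by blast
    then obtain T' where T': "open T'" "T = (S - W) \<inter> T'"
      by (auto simp: openin_open)
    then have x: "x \<in> S \<inter> T'" "x \<notin> W" using T by auto
    have "open (S \<inter> T')" using \<open>open S\<close> T' by auto
    then obtain e where "e > 0" and e: "ball x e \<subseteq> S \<inter> T'"
      using x(1) open_contains_ball by blast
    \<comment> \<open>Each point of the ball lies either in \<open>W\<close>, where \<open>K\<close>
      works, or in \<open>E n\<close>, where \<open>n\<close> works. The ball is convex, so these
      bounds integrate to a Lipschitz bound around \<open>x\<close>, contradicting that
      \<open>x\<close> is outside \<open>W\<close>.\<close>
    have "pointwise_lipschitz (max (real n) K) (ball x e) f y" if y: "y \<in> ball x e" for y
    proof (cases "y \<in> W")
      case True
      then show ?thesis
        using W e by (meson Int_subset_iff max.cobounded2 pointwise_lipschitz_le pointwise_lipschitz_subset)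
    next
      case False
      then have "y \<in> T" using y e T' by blast
      then have "y \<in> E n" using T by blast
      then have "\<forall>\<^sub>F z in at y within S. dist (f z) (f y) \<le> real n * dist z y"
        unfolding eventually_at E_def by (intro exI[of _ "1 / real (Suc n)"]) auto
      then have "pointwise_lipschitz (real n) S f y" by (rule pointwise_lipschitzI)
      then show ?thesis
        using e by (meson Int_subset_iff max.cobounded1 pointwise_lipschitz_le pointwise_lipschitz_subset)
    qed
    then have "(max (real n) K)-lipschitz_on (ball x e) f"
      using \<open>K \<ge> 0\<close> by (intro pointwise_lipschitz_imp_lipschitz_on) auto
    then have "(max (real n) K)-lipschitz_on (S \<inter> ball x e) f"
      by (rule lipschitz_on_subset) auto
    then show False
      using x \<open>e > 0\<close> unfolding W_def by blast
  qed
  then show ?thesis using W \<open>p \<in> S\<close> by blast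
qed

subsection \<open>Local similarities\<close>

text \<open>After normalising to an isometry \<open>g\<close> fixing 0, polarization shows that
  \<open>g\<close> preserves inner products. The rescaled images of the coordinate vectors are then
  orthonormal, and the coordinates of \<open>g z\<close> in this frame are those of
  \<open>z\<close>.\<close>

lemma similarity_on_ball_imp_affine:
  fixes f :: "real ^ 'n \<Rightarrow> real ^ 'n"
  assumes "\<alpha> > 0" "r > 0"
    and sim: "\<And>x y. \<lbrakk>x \<in> ball p r; y \<in> ball p r\<rbrakk> \<Longrightarrow> dist (f x) (f y) = \<alpha> * dist x y"
  shows "\<exists>A. orthogonal_matrix A \<and> (\<forall>x\<in>ball p r. f x = f p + \<alpha> *\<^sub>R (A *v (x - p)))"
proof -
  define g where "g z = (1 / \<alpha>) *\<^sub>R (f (p + z) - f p)" for z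
  have diff: "norm (g z - g w) = norm (z - w)" if "norm z < r" "norm w < r" for z w
  proof -
    have "g z - g w = (1 / \<alpha>) *\<^sub>R (f (p + z) - f (p + w))"
      by (simp add: g_def algebra_simps)
    moreover have "norm (f (p + z) - f (p + w)) = \<alpha> * norm (z - w)"
      using sim[of "p + z" "p + w"] that by (simp add: dist_norm)
    ultimately show ?thesis using \<open>\<alpha> > 0\<close> by simp
  qed
  have "g 0 = 0" by (simp add: g_def)
  have norm_g: "norm (g z) = norm z" if "norm z < r" for z
    using diff[OF that, of 0] \<open>r > 0\<close> \<open>g 0 = 0\<close> by simp
  have inner: "g z \<bullet> g w = z \<bullet> w" if "norm z < r" "norm w < r" for z w
    using diff[OF that] norm_g[OF that(1)] norm_g[OF that(2)] by (simp add: dot_norm_neg)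
  \<comment> \<open>Unit vectors may lie outside the ball, so they are shrunk by \<open>t\<close>
    before applying \<open>g\<close> and the result is scaled back.\<close>
  define t where "t = r / 2"
  have t: "0 < t" "t < r" using \<open>r > 0\<close> by (auto simp: t_def)
  define u where "u j = (1 / t) *\<^sub>R g (t *\<^sub>R axis j 1)" for j :: 'n
  have small: "norm (t *\<^sub>R axis j 1 :: real ^ 'n) < r" for j using t by (simp add: norm_axis_1)
  have uu: "u i \<bullet> u j = (if i = j then 1 else 0)" for i j
    using t inner[OF small small, of i j] by (simp add: u_def inner_axis_axis)
  have gu: "u j \<bullet> g z = z $ j" if "norm z < r" for z j
    using t inner[OF small that, of j] by (simp add: u_def inner_axis')
  define A :: "real ^ 'n ^ 'n" where "A = (\<chi> i j. u j $ i)"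
  have "transpose A ** A = mat 1"
    using uu by (simp add: vec_eq_iff matrix_matrix_mult_def transpose_def mat_def A_def inner_vec_def)
  then have A: "orthogonal_matrix A" by (simp add: orthogonal_matrix)
  have "g z = A *v z" if "norm z < r" for z
  proof -
    have "transpose A *v g z = z"
      using gu[OF that] by (simp add: vec_eq_iff matrix_vector_mult_def transpose_def A_def inner_vec_def)
    then have "A *v z = (A ** transpose A) *v g z"
      by (metis matrix_vector_mul_assoc)
    then show ?thesis using A by (simp add: orthogonal_matrix_def)
  qed
  moreover have "f x = f p + \<alpha> *\<^sub>R g (x - p)" for x
    using \<open>\<alpha> > 0\<close> by (simp add: g_def)
  ultimately have "f x = f p + \<alpha> *\<^sub>R (A *v (x - p))" if "x \<in> ball p r" for x
    using that by (metis dist_commute dist_norm mem_ball)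
  then show ?thesis using A by blast
qed

text \<open>The local matrices are determined by the derivative, hence locally constant, hence
  constant on the connected set; subtracting the common linear part leaves a map with derivative
  0.\<close>

lemma local_similarity_imp_affine:
  fixes f :: "real ^ 'n \<Rightarrow> real ^ 'n"
  assumes "open S" "connected S" "\<alpha> > 0"
    and loc: "\<And>p. p \<in> S \<Longrightarrow> \<exists>r>0. \<forall>x\<in>ball p r. \<forall>y\<in>ball p r. dist (f x) (f y) = \<alpha> * dist x y"
  shows "\<exists>A b. orthogonal_matrix A \<and> (\<forall>x\<in>S. f x = \<alpha> *\<^sub>R (A *v x) + b)"
proof (cases "S = {}")
  case True
  then show ?thesis using orthogonal_matrix_id by blast
next
  case False
  then obtain p0 where "p0 \<in> S" by blast
  have "\<exists>A r. orthogonal_matrix A \<and> r > 0 \<and>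
      (\<forall>x\<in>ball p r. f x = f p + \<alpha> *\<^sub>R (A *v (x - p)))" if "p \<in> S" for p
    using loc[OF that] similarity_on_ball_imp_affine[OF \<open>\<alpha> > 0\<close>, of _ p f] by blast
  then obtain A r where A: "\<And>p. p \<in> S \<Longrightarrow> orthogonal_matrix (A p)"
    and r: "\<And>p. p \<in> S \<Longrightarrow> r p > 0"
    and f: "\<And>p x. \<lbrakk>p \<in> S; x \<in> ball p (r p)\<rbrakk> \<Longrightarrow> f x = f p + \<alpha> *\<^sub>R (A p *v (x - p))"
    by metis
  have deriv: "(f has_derivative (\<lambda>z. \<alpha> *\<^sub>R (A p *v z))) (at y)"
    if "p \<in> S" "y \<in> ball p (r p)" for p y
  proof (rule has_derivative_transform_within_open[OF _ open_ball \<open>y \<in> ball p (r p)\<close>])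
    have "((\<lambda>x. A p *v (x - p)) has_derivative (\<lambda>z. A p *v (z - 0))) (at y)"
      by (intro bounded_linear.has_derivative[OF matrix_vector_mul_bounded_linear]
          has_derivative_diff has_derivative_ident has_derivative_const)
    then show "((\<lambda>x. f p + \<alpha> *\<^sub>R (A p *v (x - p))) has_derivative (\<lambda>z. \<alpha> *\<^sub>R (A p *v z))) (at y)"
      by (auto intro!: derivative_eq_intros)
  qed (use f that in auto)
  have const: "A p = A p0" if "p \<in> S" for p
  proof (rule connected_local_const[OF \<open>connected S\<close> that \<open>p0 \<in> S\<close>, where f = A], intro ballI)
    fix q assume "q \<in> S"
    have "A q = A y" if "y \<in> S" "y \<in> ball q (r q)" for y
    proof -
      \<comment> \<open>Both sides are the derivative of \<open>f\<close> at \<open>y\<close>, read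
        off from the affine form around \<open>q\<close> and from the one around
        \<open>y\<close>.\<close>
      have "(\<lambda>z. \<alpha> *\<^sub>R (A q *v z)) = (\<lambda>z. \<alpha> *\<^sub>R (A y *v z))"
        using that r \<open>q \<in> S\<close>
        by (intro has_derivative_unique[OF deriv deriv]) auto
      then show ?thesis using \<open>\<alpha> > 0\<close> by (simp add: fun_eq_iff matrix_eq)
    qed
    then show "\<forall>\<^sub>F y in at q within S. A q = A y"
      using r[OF \<open>q \<in> S\<close>] by (auto simp: eventually_at dist_commute)
  qed
  have "f x - \<alpha> *\<^sub>R (A p0 *v x) = f p0 - \<alpha> *\<^sub>R (A p0 *v p0)" if "x \<in> S" for x
  proof (rule has_derivative_zero_unique_connected[OF \<open>open S\<close> \<open>connected S\<close> _ that \<open>p0 \<in> S\<close>])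
    fix y assume "y \<in> S"
    then have "(f has_derivative (\<lambda>z. \<alpha> *\<^sub>R (A p0 *v z))) (at y)"
      using deriv[of y y] r const by simp
    moreover have "((\<lambda>x. A p0 *v x) has_derivative (\<lambda>z. A p0 *v z)) (at y)"
      by (intro bounded_linear_imp_has_derivative matrix_vector_mul_bounded_linear)
    ultimately show "((\<lambda>x. f x - \<alpha> *\<^sub>R (A p0 *v x)) has_derivative (\<lambda>_. 0)) (at y)"
      by (auto intro!: derivative_eq_intros)
  qed
  then have "\<forall>x\<in>S. f x = \<alpha> *\<^sub>R (A p0 *v x) + (f p0 - \<alpha> *\<^sub>R (A p0 *v p0))"
    by (metis add.commute diff_add_cancel)
  then show ?thesis using A[OF \<open>p0 \<in> S\<close>] by blast
qed

subsection \<open>Operators preserving Lipschitz constants\<close>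

text \<open>
  \<open>L\<close> stands for either of the two Lipschitz constants; all that matters is that it lies between
  the pointwise constant and the Lipschitz constant on any neighbourhood.
\<close>
locale lipschitz_constant_preserving =
  fixes L :: "'a::euclidean_space set \<Rightarrow> ('a \<Rightarrow> real) \<Rightarrow> 'a \<Rightarrow> ennreal"
    and U V :: "'a set" and \<phi> :: "'a \<Rightarrow> 'a" and h :: "'a \<Rightarrow> real"
  assumes L_le_lipschitz:
      "\<And>X p r C f. \<lbrakk>p \<in> X; r > 0; C-lipschitz_on (X \<inter> ball p r) f\<rbrakk> \<Longrightarrow> L X f p \<le> ennreal C"
    and L_pt_le: "\<And>X p f. p \<in> X \<Longrightarrow> L_pt X f p \<le> L X f p"
    and V_nonempty: "V \<noteq> {}"
    and V_open_or_convex: "open V \<and> connected V \<or> convex V"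
    and \<phi>: "\<phi> \<in> V \<rightarrow> U"
    and bij: "bij_betw (weighted_comp V h \<phi>)
        {f \<in> extensional U. \<forall>p\<in>U. L U f p < \<infinity>} {f \<in> extensional V. \<forall>p\<in>V. L V f p < \<infinity>}"
    and preserves: "\<And>f p. \<lbrakk>f \<in> Lip U; p \<in> V\<rbrakk> \<Longrightarrow> L V (weighted_comp V h \<phi> f) p = L U f (\<phi> p)"
begin

text \<open>\<open>F X\<close> becomes \<open>Lip_loc X\<close> or \<open>Lip_pt X\<close> according
  to the choice of \<open>L\<close>; the two sets in \<open>bij\<close> are \<open>F U\<close> and
  \<open>F V\<close>.\<close>

definition F :: "'a set \<Rightarrow> ('a \<Rightarrow> real) set" where
  "F X = {f \<in> extensional X. \<forall>p\<in>X. L X f p < \<infinity>}"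

lemma pointwise_lipschitz_if_L_le:
  assumes "p \<in> X" "L X f p \<le> ennreal C" "C \<ge> 0"
  shows "pointwise_lipschitz C X f p"
  using L_pt_le[OF assms(1)] assms by (intro L_pt_le_imp_pointwise_lipschitz) (auto intro: order_trans)

lemma F_pointwise_lipschitz:
  assumes "f \<in> F X" "p \<in> X"
  shows "\<exists>C\<ge>0. pointwise_lipschitz C X f p"
proof -
  have "L X f p < \<infinity>" using assms by (simp add: F_def)
  then have "L X f p \<le> ennreal (enn2real (L X f p))" by simp
  then show ?thesis
    using pointwise_lipschitz_if_L_le[OF assms(2)] enn2real_nonneg by blast
qed

lemma F_continuous_on: "f \<in> F X \<Longrightarrow> continuous_on X f"
  by (rule pointwise_lipschitz_imp_continuous_on) (use F_pointwise_lipschitz in blast)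

text \<open>Supplies test functions for either choice of \<open>L\<close>; restriction makes them
  extensional.\<close>

lemma restrict_in_F:
  assumes "\<And>p. p \<in> X \<Longrightarrow> \<exists>r>0. \<exists>C. C-lipschitz_on (X \<inter> ball p r) f"
  shows "restrict f X \<in> F X"
  unfolding F_def
proof (intro CollectI conjI ballI)
  fix p assume "p \<in> X"
  then obtain r C where "r > 0" "C-lipschitz_on (X \<inter> ball p r) f" using assms by blast
  then have "C-lipschitz_on (X \<inter> ball p r) (restrict f X)" by (simp add: lipschitz_on_def)
  then have "L X (restrict f X) p \<le> ennreal C"
    using \<open>p \<in> X\<close> \<open>r > 0\<close> by (intro L_le_lipschitz)
  also have "\<dots> < \<infinity>" by simp
  finally show "L X (restrict f X) p < \<infinity>" .
qed simp

lemma restrict_in_F_if_lipschitz: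
  assumes "C-lipschitz_on X f"
  shows "restrict f X \<in> F X"
proof (rule restrict_in_F)
  have "C-lipschitz_on (X \<inter> ball p 1) f" for p by (rule lipschitz_on_subset[OF assms]) auto
  then show "\<exists>r>0. \<exists>C. C-lipschitz_on (X \<inter> ball p r) f" for p using zero_less_one by blast
qed

lemma restrict_in_Lip: "C-lipschitz_on X f \<Longrightarrow> restrict f X \<in> Lip X"
  unfolding Lip_def by (auto simp: lipschitz_on_def)

lemma weighted_comp_surj:
  assumes "g \<in> F V"
  shows "\<exists>f\<in>F U. \<forall>y\<in>V. h y * f (\<phi> y) = g y"
proof -
  obtain f where f: "f \<in> F U" "weighted_comp V h \<phi> f = g"
    using assms bij unfolding F_def bij_betw_def by (metis (no_types, lifting) imageE)
  then have "\<forall>y\<in>V. h y * f (\<phi> y) = g y" by (auto simp: weighted_comp_def)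
  then show ?thesis using f by blast
qed

text \<open>Carries a Lipschitz bound on the image near \<open>p\<close> back to the point
  \<open>\<phi> p\<close>.\<close>

lemma preserves_le:
  assumes f: "C-lipschitz_on U f" and "p \<in> V" "r > 0"
    and D: "D-lipschitz_on (V \<inter> ball p r) (\<lambda>y. h y * f (\<phi> y))"
  shows "L U (restrict f U) (\<phi> p) \<le> ennreal D"
proof -
  have "D-lipschitz_on (V \<inter> ball p r) (weighted_comp V h \<phi> (restrict f U))"
    using D \<phi> by (auto simp: lipschitz_on_def weighted_comp_def Pi_iff)
  then have "L V (weighted_comp V h \<phi> (restrict f U)) p \<le> ennreal D"
    using assms by (intro L_le_lipschitz)
  then show ?thesis
    using preserves[OF restrict_in_Lip[OF f] \<open>p \<in> V\<close>] by simp
qed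

text \<open>Carries a bound in the direction from \<open>U\<close> to \<open>V\<close>. Only a
  pointwise bound results, since \<open>L\<close> is known to dominate just the pointwise
  constant.\<close>

lemma preserves_ge:
  assumes f: "C-lipschitz_on U f" and "p \<in> V"
  shows "pointwise_lipschitz C V (\<lambda>y. h y * f (\<phi> y)) p"
proof -
  have "\<phi> p \<in> U" using \<phi> \<open>p \<in> V\<close> by auto
  moreover have "C-lipschitz_on (U \<inter> ball (\<phi> p) 1) (restrict f U)"
    using f by (auto simp: lipschitz_on_def)
  ultimately have "L U (restrict f U) (\<phi> p) \<le> ennreal C"
    by (intro L_le_lipschitz[of _ _ 1]) auto
  then have "L V (weighted_comp V h \<phi> (restrict f U)) p \<le> ennreal C"
    using preserves[OF restrict_in_Lip[OF f] \<open>p \<in> V\<close>] by simp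
  then have pl: "pointwise_lipschitz C V (weighted_comp V h \<phi> (restrict f U)) p"
    using lipschitz_on_nonneg[OF f] \<open>p \<in> V\<close> by (intro pointwise_lipschitz_if_L_le)
  have eq: "weighted_comp V h \<phi> (restrict f U) y = h y * f (\<phi> y)" if "y \<in> V" for y
    using that \<phi> by (auto simp: weighted_comp_def)
  show ?thesis
    using iffD1[OF pointwise_lipschitz_cong[OF eq \<open>p \<in> V\<close>] pl] .
qed

section \<open>The weight and the continuity of \<open>\<phi>\<close>\<close>

lemma weight_constant: "\<exists>c. c \<noteq> 0 \<and> (\<forall>v\<in>V. h v = c)"
proof -
  have "pointwise_lipschitz 0 V h p" if "p \<in> V" for p
    using preserves_ge[of 0 "\<lambda>_. 1" p] that by (simp add: lipschitz_on_constant)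
  then have deriv: "(h has_derivative (\<lambda>_. 0)) (at p within V)" if "p \<in> V" for p
    using that by (intro pointwise_lipschitz_0_imp_has_derivative_0)
  obtain v0 where "v0 \<in> V" using V_nonempty by blast
  have const: "h v = h v0" if "v \<in> V" for v
    using V_open_or_convex
  proof
    assume V: "open V \<and> connected V"
    then show ?thesis
      using deriv at_within_open[of _ V] that \<open>v0 \<in> V\<close>
      by (intro has_derivative_zero_unique_connected[of V h]) auto
  next
    assume "convex V"
    then show ?thesis
      using deriv that \<open>v0 \<in> V\<close> by (rule has_derivative_zero_unique)
  qed
  \<comment> \<open>Every function in the image vanishes at zeros of \<open>h\<close>, while by
    surjectivity the constant 1 is in the image.\<close>
  have "restrict (\<lambda>_. 1) V \<in> F V" by (rule restrict_in_F_if_lipschitz[OF lipschitz_on_constant])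
  then have "h v0 \<noteq> 0" using weighted_comp_surj \<open>v0 \<in> V\<close> by fastforce
  then show ?thesis using const by blast
qed

definition c :: real where "c = (SOME c. c \<noteq> 0 \<and> (\<forall>v\<in>V. h v = c))"

lemma c_spec: "c \<noteq> 0 \<and> (\<forall>v\<in>V. h v = c)"
  using someI_ex[OF weight_constant] unfolding c_def .

lemmas c_nonzero = conjunct1[OF c_spec]
  and weight_eq = bspec[OF conjunct2[OF c_spec]]

text \<open>The test function is the distance to \<open>\<phi> p\<close>: its image vanishes at
  \<open>p\<close> and elsewhere has absolute value \<open>\<bar>c\<bar>\<close> times the
  displacement of \<open>\<phi>\<close>.\<close>

lemma pointwise_lipschitz_phi:
  assumes "p \<in> V"
  shows "pointwise_lipschitz (1 / \<bar>c\<bar>) V \<phi> p"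
  unfolding pointwise_lipschitz_def
proof (intro allI impI)
  fix \<epsilon> :: real assume "\<epsilon> > 0"
  have "1-lipschitz_on U (\<lambda>x. dist x (\<phi> p))"
    by (auto simp: lipschitz_on_def dist_real_def dist_diff_le)
  then have "pointwise_lipschitz 1 V (\<lambda>y. h y * dist (\<phi> y) (\<phi> p)) p"
    using assms by (rule preserves_ge)
  \<comment> \<open>The slack \<open>\<epsilon> * \<bar>c\<bar>\<close> becomes
    \<open>\<epsilon>\<close> after division by \<open>\<bar>c\<bar>\<close>.\<close>
  then have "\<forall>\<^sub>F y in at p within V. dist (h y * dist (\<phi> y) (\<phi> p)) 0 \<le> (1 + \<epsilon> * \<bar>c\<bar>) * dist y p"
    using \<open>\<epsilon> > 0\<close> c_nonzero by (simp add: pointwise_lipschitz_def)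
  moreover have "\<forall>\<^sub>F y in at p within V. y \<in> V" by (simp add: eventually_at_filter)
  ultimately show "\<forall>\<^sub>F y in at p within V. dist (\<phi> y) (\<phi> p) \<le> (1 / \<bar>c\<bar> + \<epsilon>) * dist y p"
    by eventually_elim (use c_nonzero in \<open>simp add: weight_eq abs_mult field_simps\<close>)
qed

lemma continuous_on_phi: "continuous_on V \<phi>"
  by (rule pointwise_lipschitz_imp_continuous_on) (use pointwise_lipschitz_phi in blast)

text \<open>A nonzero bump function supported away from the image of \<open>\<phi>\<close> would be
  sent to 0, contradicting injectivity of the operator.\<close>

lemma phi_dense: "U \<subseteq> closure (\<phi> ` V)"
proof
  fix u assume "u \<in> U"
  show "u \<in> closure (\<phi> ` V)"
  proof (rule ccontr)
    assume "u \<notin> closure (\<phi> ` V)"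
    then obtain e where "e > 0" and e: "\<And>y. y \<in> V \<Longrightarrow> e \<le> dist (\<phi> y) u"
      by (auto simp: closure_approachable not_less)
    have "1-lipschitz_on U (\<lambda>x. max 0 (e - dist x u))"
    proof (rule lipschitz_onI)
      fix x y :: 'a
      show "dist (max 0 (e - dist x u)) (max 0 (e - dist y u)) \<le> 1 * dist x y"
        using dist_diff_le[of x u y] by (auto simp: dist_real_def)
    qed simp
    then have "restrict (\<lambda>x. max 0 (e - dist x u)) U \<in> F U" by (rule restrict_in_F_if_lipschitz)
    moreover have "restrict (\<lambda>x. 0) U \<in> F U" by (rule restrict_in_F_if_lipschitz[OF lipschitz_on_constant])
    moreover have "weighted_comp V h \<phi> (restrict (\<lambda>x. max 0 (e - dist x u)) U) =
        weighted_comp V h \<phi> (restrict (\<lambda>x. 0) U)"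
      using e \<phi> by (fastforce simp: weighted_comp_def)
    ultimately have "restrict (\<lambda>x. max 0 (e - dist x u)) U = restrict (\<lambda>x. 0) U"
      using bij_betw_imp_inj_on[OF bij] by (auto simp: F_def dest: inj_onD)
    then have "max 0 (e - dist u u) = 0" using \<open>u \<in> U\<close> by (metis restrict_apply')
    then show False using \<open>e > 0\<close> by simp
  qed
qed

text \<open>
  The coordinates of the inverse are the preimages of the coordinate functions under the operator.
  It takes values in \<open>V\<close>: otherwise \<open>1 / dist y (\<psi> u)\<close> would have a preimage, although it is
  unbounded along points \<open>y\<close> with \<open>\<phi> y\<close> close to \<open>u\<close>.
\<close>
lemma phi_inverse:
  "\<exists>\<psi>. \<psi> \<in> U \<rightarrow> V \<and> (\<forall>y\<in>V. \<psi> (\<phi> y) = y) \<and> (\<forall>x\<in>U. \<phi> (\<psi> x) = x) \<and>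
       (\<forall>q\<in>U. \<exists>C\<ge>0. pointwise_lipschitz C U \<psi> q)"
proof -
  have "\<exists>f\<in>F U. \<forall>y\<in>V. h y * f (\<phi> y) = y \<bullet> b" if "b \<in> Basis" for b
  proof -
    have "1-lipschitz_on V (\<lambda>y. y \<bullet> b)"
    proof (rule lipschitz_onI)
      fix x y :: 'a
      show "dist (x \<bullet> b) (y \<bullet> b) \<le> 1 * dist x y"
        using Basis_le_norm[OF that, of "x - y"] by (simp add: dist_norm inner_diff_left)
    qed simp
    from weighted_comp_surj[OF restrict_in_F_if_lipschitz[OF this]] show ?thesis by simp
  qed
  then obtain f where f: "\<And>b. b \<in> Basis \<Longrightarrow> f b \<in> F U"
    "\<And>b y. \<lbrakk>b \<in> Basis; y \<in> V\<rbrakk> \<Longrightarrow> h y * f b (\<phi> y) = y \<bullet> b" by metis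
  \<comment> \<open>Since \<open>h\<close> equals \<open>c\<close> on \<open>V\<close>, multiplying
    the preimage \<open>f b\<close> by \<open>c\<close> recovers the coordinate of \<open>y\<close>
    along \<open>b\<close> at \<open>\<phi> y\<close>.\<close>
  define \<psi> where "\<psi> x = (\<Sum>b\<in>Basis. (c * f b x) *\<^sub>R b)" for x
  have \<psi>\<phi>: "\<psi> (\<phi> y) = y" if "y \<in> V" for y
  proof -
    have "\<psi> (\<phi> y) = (\<Sum>b\<in>Basis. (y \<bullet> b) *\<^sub>R b)"
      unfolding \<psi>_def using f(2)[OF _ that] weight_eq[OF that] by (intro sum.cong) auto
    then show ?thesis by (simp add: euclidean_representation)
  qed
  have pl: "\<exists>C\<ge>0. pointwise_lipschitz C U \<psi> q" if "q \<in> U" for q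
  proof -
    have "\<forall>b\<in>Basis. \<exists>C\<ge>0. pointwise_lipschitz C U (f b) q"
      using F_pointwise_lipschitz[OF f(1) that] by blast
    then obtain C where C: "\<And>b. b \<in> Basis \<Longrightarrow> C b \<ge> 0"
      "\<And>b. b \<in> Basis \<Longrightarrow> pointwise_lipschitz (C b) U (f b) q" by metis
    have "\<forall>\<^sub>F x in at q within U. \<forall>b\<in>Basis. dist (f b x) (f b q) \<le> (C b + 1) * dist x q"
      using C(2) unfolding pointwise_lipschitz_def by (intro eventually_ball_finite) (auto simp: zero_less_one)
    then have "\<forall>\<^sub>F x in at q within U. dist (\<psi> x) (\<psi> q) \<le> (\<Sum>b\<in>Basis. \<bar>c\<bar> * (C b + 1)) * dist x q"
    proof eventually_elim
      case (elim x)
      have "dist (\<psi> x) (\<psi> q) = norm (\<Sum>b\<in>Basis. (c * (f b x - f b q)) *\<^sub>R b)"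
        by (simp add: dist_norm \<psi>_def sum_subtractf[symmetric] algebra_simps)
      also have "\<dots> \<le> (\<Sum>b\<in>Basis. \<bar>c\<bar> * dist (f b x) (f b q))"
        by (rule sum_norm_le) (simp add: abs_mult dist_real_def)
      also have "\<dots> \<le> (\<Sum>b\<in>Basis. \<bar>c\<bar> * ((C b + 1) * dist x q))"
        using elim by (intro sum_mono mult_left_mono) auto
      also have "\<dots> = (\<Sum>b\<in>Basis. \<bar>c\<bar> * (C b + 1)) * dist x q"
        by (simp add: sum_distrib_right mult.assoc)
      finally show ?case .
    qed
    then have "pointwise_lipschitz (\<Sum>b\<in>Basis. \<bar>c\<bar> * (C b + 1)) U \<psi> q" by (rule pointwise_lipschitzI)
    moreover have "(\<Sum>b\<in>Basis. \<bar>c\<bar> * (C b + 1)) \<ge> 0"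
      using C(1) by (intro sum_nonneg mult_nonneg_nonneg) (auto simp: add_nonneg_nonneg)
    ultimately show ?thesis by blast
  qed
  have cont: "continuous_on U \<psi>"
    by (rule pointwise_lipschitz_imp_continuous_on) (use pl in blast)
  have \<phi>V: "\<phi> ` V \<subseteq> U" using \<phi> by auto
  have \<psi>V: "\<psi> u \<in> V" if "u \<in> U" for u
  proof (rule ccontr)
    assume "\<psi> u \<notin> V"
    have "restrict (\<lambda>y. 1 / dist y (\<psi> u)) V \<in> F V"
    proof (rule restrict_in_F)
      fix p assume "p \<in> V"
      define d where "d = dist p (\<psi> u)"
      have "d > 0" using \<open>p \<in> V\<close> \<open>\<psi> u \<notin> V\<close> by (auto simp: d_def)
      \<comment> \<open>On this ball all distances to \<open>\<psi> u\<close> are at least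
        \<open>d/2\<close>, so the denominator in the difference of two reciprocals is at least the
        square of \<open>d/2\<close>.\<close>
      have "(1 / (d/2)\<^sup>2)-lipschitz_on (V \<inter> ball p (d/2)) (\<lambda>y. 1 / dist y (\<psi> u))"
      proof (rule lipschitz_onI)
        fix x y assume xy: "x \<in> V \<inter> ball p (d/2)" "y \<in> V \<inter> ball p (d/2)"
        have ge: "d/2 \<le> dist z (\<psi> u)" if "z \<in> V \<inter> ball p (d/2)" for z
          using that dist_triangle[of p "\<psi> u" z] by (simp add: d_def)
        have "(d/2)\<^sup>2 \<le> dist x (\<psi> u) * dist y (\<psi> u)"
          unfolding power2_eq_square using ge[OF xy(1)] ge[OF xy(2)] \<open>d > 0\<close> by (intro mult_mono) auto
        moreover have "dist (1 / dist x (\<psi> u)) (1 / dist y (\<psi> u)) =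
            \<bar>dist x (\<psi> u) - dist y (\<psi> u)\<bar> / (dist x (\<psi> u) * dist y (\<psi> u))"
        proof -
          have "dist x (\<psi> u) > 0" "dist y (\<psi> u) > 0"
            using ge[OF xy(1)] ge[OF xy(2)] \<open>d > 0\<close> by linarith+
          then have "1 / dist x (\<psi> u) - 1 / dist y (\<psi> u) =
              (dist y (\<psi> u) - dist x (\<psi> u)) / (dist x (\<psi> u) * dist y (\<psi> u))"
            by (simp add: field_simps)
          then show ?thesis by (simp add: dist_real_def abs_minus_commute abs_mult)
        qed
        moreover have "\<bar>dist x (\<psi> u) - dist y (\<psi> u)\<bar> \<le> dist x y" by (rule dist_diff_le)
        ultimately have "dist (1 / dist x (\<psi> u)) (1 / dist y (\<psi> u)) \<le> dist x y / (d/2)\<^sup>2"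
          using \<open>d > 0\<close> by (auto intro!: frac_le)
        then show "dist (1 / dist x (\<psi> u)) (1 / dist y (\<psi> u)) \<le> 1 / (d/2)\<^sup>2 * dist x y" by simp
      qed simp
      then show "\<exists>r>0. \<exists>C. C-lipschitz_on (V \<inter> ball p r) (\<lambda>y. 1 / dist y (\<psi> u))"
        using \<open>d > 0\<close> by (intro exI[of _ "d/2"]) auto
    qed
    then obtain g where g: "g \<in> F U" "\<And>y. y \<in> V \<Longrightarrow> h y * g (\<phi> y) = 1 / dist y (\<psi> u)"
      using weighted_comp_surj by fastforce
    \<comment> \<open>This continuous function is 1 on the dense image of \<open>\<phi>\<close> but
      0 at \<open>u\<close>, because of the factor
      \<open>dist (\<psi> x) (\<psi> u)\<close>.\<close>
    have cont_g: "continuous_on U (\<lambda>x. c * g x * dist (\<psi> x) (\<psi> u))"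
      by (intro continuous_intros cont F_continuous_on[OF g(1)])
    have "c * g x * dist (\<psi> x) (\<psi> u) = 1" if "x \<in> \<phi> ` V" for x
    proof -
      obtain y where y: "y \<in> V" "x = \<phi> y" using \<open>x \<in> \<phi> ` V\<close> by blast
      moreover have "dist y (\<psi> u) \<noteq> 0" using y \<open>\<psi> u \<notin> V\<close> by auto
      ultimately show ?thesis
        using g(2)[OF y(1)] weight_eq[OF y(1)] \<psi>\<phi>[OF y(1)] by simp
    qed
    from continuous_constant_on_dense[OF cont_g \<phi>V phi_dense this \<open>u \<in> U\<close>]
    show False by simp
  qed
  have "\<phi> (\<psi> u) - u = 0" if "u \<in> U" for u
  proof -
    have "continuous_on U (\<lambda>x. \<phi> (\<psi> x) - x)"
      using \<psi>V by (intro continuous_intros continuous_on_compose2[OF continuous_on_phi cont]) auto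
    moreover have "\<phi> (\<psi> x) - x = 0" if "x \<in> \<phi> ` V" for x
      using that \<psi>\<phi> by auto
    ultimately show ?thesis
      using continuous_constant_on_dense[OF _ \<phi>V phi_dense _ that] by blast
  qed
  then show ?thesis using \<psi>\<phi> \<psi>V pl by (intro exI[of _ \<psi>]) auto
qed

definition \<psi> :: "'a \<Rightarrow> 'a" where
  "\<psi> = (SOME \<psi>. \<psi> \<in> U \<rightarrow> V \<and> (\<forall>y\<in>V. \<psi> (\<phi> y) = y) \<and> (\<forall>x\<in>U. \<phi> (\<psi> x) = x) \<and>
       (\<forall>q\<in>U. \<exists>C\<ge>0. pointwise_lipschitz C U \<psi> q))"

lemma psi_inverse: "\<psi> \<in> U \<rightarrow> V \<and> (\<forall>y\<in>V. \<psi> (\<phi> y) = y) \<and> (\<forall>x\<in>U. \<phi> (\<psi> x) = x) \<and>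
       (\<forall>q\<in>U. \<exists>C\<ge>0. pointwise_lipschitz C U \<psi> q)"
  using someI_ex[OF phi_inverse] unfolding \<psi>_def .

lemmas psi = conjunct1[OF psi_inverse]
  and psi_phi = bspec[OF conjunct1[OF conjunct2[OF psi_inverse]]]
  and phi_psi = bspec[OF conjunct1[OF conjunct2[OF conjunct2[OF psi_inverse]]]]
  and pointwise_lipschitz_psi = bspec[OF conjunct2[OF conjunct2[OF conjunct2[OF psi_inverse]]]]

text \<open>
  The function \<open>dist (\<psi> x) (\<psi> q) / \<bar>c\<bar>\<close>, truncated to become Lipschitz on all of \<open>U\<close>, is mapped to
  \<open>\<plusminus>dist y (\<psi> q)\<close> near \<open>\<psi> q\<close>.
\<close>
lemma pointwise_lipschitz_psi_improve:
  assumes "q \<in> U" "r > 0" and M: "M-lipschitz_on (U \<inter> ball q r) \<psi>"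
  shows "pointwise_lipschitz \<bar>c\<bar> U \<psi> q"
proof -
  define g where "g x = dist (\<psi> x) (\<psi> q) / \<bar>c\<bar>" for x
  define f where "f x = (if dist x q < r then min (g x) (M / \<bar>c\<bar> * (r - dist x q)) else 0)" for x
  have "M \<ge> 0" using M by (rule lipschitz_on_nonneg)
  have g: "(M / \<bar>c\<bar>)-lipschitz_on (U \<inter> ball q r) g"
  proof (rule lipschitz_onI)
    fix x y assume "x \<in> U \<inter> ball q r" "y \<in> U \<inter> ball q r"
    then have "dist (\<psi> x) (\<psi> y) \<le> M * dist x y" by (rule lipschitz_onD[OF M])
    then have "\<bar>dist (\<psi> x) (\<psi> q) - dist (\<psi> y) (\<psi> q)\<bar> \<le> M * dist x y"
      using dist_diff_le[of "\<psi> x" "\<psi> q" "\<psi> y"] by linarith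
    then show "dist (g x) (g y) \<le> M / \<bar>c\<bar> * dist x y"
      by (simp add: g_def dist_real_def diff_divide_distrib[symmetric] divide_right_mono)
  qed (use \<open>M \<ge> 0\<close> in simp)
  have f: "(M / \<bar>c\<bar>)-lipschitz_on U f"
    unfolding f_def using g by (rule lipschitz_on_truncate) (simp add: g_def)
  \<comment> \<open>Within half the radius the truncation is inactive: \<open>g\<close> vanishes at
    \<open>q\<close> and grows with slope at most that of the cone.\<close>
  have fg: "f x = g x" if "x \<in> U" "dist x q < r / 2" for x
  proof -
    have "g x \<le> M / \<bar>c\<bar> * dist x q"
      using lipschitz_onD[OF g, of x q] that \<open>q \<in> U\<close> \<open>r > 0\<close>
      by (simp add: g_def dist_commute)
    also have "\<dots> \<le> M / \<bar>c\<bar> * (r - dist x q)"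
      using that \<open>M \<ge> 0\<close> by (intro mult_left_mono) auto
    finally show ?thesis using that \<open>r > 0\<close> by (simp add: f_def)
  qed
  define p where "p = \<psi> q"
  have p: "p \<in> V" "\<phi> p = q" using psi phi_psi \<open>q \<in> U\<close> by (auto simp: p_def)
  \<comment> \<open>By continuity, \<open>\<phi>\<close> maps the part of \<open>V\<close> within
    \<open>s\<close> of \<open>p\<close> into the region where \<open>f\<close> and \<open>g\<close>
    agree.\<close>
  obtain s where "s > 0" and s: "\<And>y. \<lbrakk>y \<in> V; dist y p < s\<rbrakk> \<Longrightarrow> dist (\<phi> y) q < r / 2"
    using continuous_on_phi p \<open>r > 0\<close> unfolding continuous_on_iff by (metis half_gt_zero)
  have "1-lipschitz_on (V \<inter> ball p s) (\<lambda>y. h y * f (\<phi> y))"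
  proof (rule lipschitz_onI)
    have eq: "h y * f (\<phi> y) = sgn c * dist y p" if "y \<in> V \<inter> ball p s" for y
    proof -
      have "f (\<phi> y) = g (\<phi> y)" using that s \<phi> by (intro fg) (auto simp: dist_commute)
      then show ?thesis
        using that weight_eq psi_phi by (simp add: g_def p_def sgn_div_norm divide_inverse mult_ac)
    qed
    fix x y assume "x \<in> V \<inter> ball p s" "y \<in> V \<inter> ball p s"
    then have "dist (h x * f (\<phi> x)) (h y * f (\<phi> y)) = \<bar>dist x p - dist y p\<bar>"
      using c_nonzero
      by (simp only: eq dist_real_def right_diff_distrib[symmetric] abs_mult) (simp add: abs_sgn_eq)
    then show "dist (h x * f (\<phi> x)) (h y * f (\<phi> y)) \<le> 1 * dist x y"
      by (simp add: dist_diff_le)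
  qed simp
  then have "L U (restrict f U) q \<le> ennreal 1"
    using preserves_le[OF f p(1) \<open>s > 0\<close>] p(2) by blast
  then have pl: "pointwise_lipschitz 1 U (restrict f U) q"
    using \<open>q \<in> U\<close> by (intro pointwise_lipschitz_if_L_le) auto
  show ?thesis
    unfolding pointwise_lipschitz_def
  proof (intro allI impI)
    fix \<epsilon> :: real assume "\<epsilon> > 0"
    then have "\<epsilon> / \<bar>c\<bar> > 0" using c_nonzero by simp
    with pl have "\<forall>\<^sub>F x in at q within U.
        dist (restrict f U x) (restrict f U q) \<le> (1 + \<epsilon> / \<bar>c\<bar>) * dist x q"
      unfolding pointwise_lipschitz_def by blast
    moreover have "\<forall>\<^sub>F x in at q within U. x \<in> U \<and> dist x q < r / 2"
      using \<open>r > 0\<close> by (auto simp: eventually_at intro!: exI[of _ "r / 2"])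
    ultimately show "\<forall>\<^sub>F x in at q within U. dist (\<psi> x) (\<psi> q) \<le> (\<bar>c\<bar> + \<epsilon>) * dist x q"
    proof eventually_elim
      case (elim x)
      then have "dist (\<psi> x) (\<psi> q) / \<bar>c\<bar> \<le> (1 + \<epsilon> / \<bar>c\<bar>) * dist x q"
        using fg[of x] fg[of q] \<open>q \<in> U\<close> \<open>r > 0\<close> by (simp add: g_def dist_real_def)
      then show ?case using c_nonzero by (simp add: field_simps)
    qed
  qed
qed

section \<open>Local similarity on the interior\<close>

lemma pointwise_lipschitz_psi_interior:
  assumes "q \<in> interior U"
  shows "pointwise_lipschitz \<bar>c\<bar> (interior U) \<psi> q"
proof (rule pointwise_lipschitz_Baire)
  fix p assume "p \<in> interior U"
  then have "p \<in> U" by (rule subsetD[OF interior_subset])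
  from pointwise_lipschitz_psi[OF this] obtain C where "pointwise_lipschitz C U \<psi> p" by blast
  from pointwise_lipschitz_subset[OF this interior_subset]
  show "\<exists>C. pointwise_lipschitz C (interior U) \<psi> p" ..
next
  fix p r C assume p: "p \<in> interior U" "r > 0" and C: "C-lipschitz_on (interior U \<inter> ball p r) \<psi>"
  \<comment> \<open>The improvement step needs a Lipschitz bound relative to all of
    \<open>U\<close>, so the ball is shrunk until it lies inside the interior.\<close>
  have "open (interior U \<inter> ball p r)" "p \<in> interior U \<inter> ball p r" using p by auto
  then obtain e where e: "e > 0" "ball p e \<subseteq> interior U \<inter> ball p r"
    by (meson open_contains_ball)
  then have "C-lipschitz_on (U \<inter> ball p e) \<psi>"
    by (intro lipschitz_on_subset[OF C]) auto
  then have "pointwise_lipschitz \<bar>c\<bar> U \<psi> p"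
    using p e interior_subset[of U] by (intro pointwise_lipschitz_psi_improve) auto
  then show "pointwise_lipschitz \<bar>c\<bar> (interior U) \<psi> p"
    by (rule pointwise_lipschitz_subset) (rule interior_subset)
qed (use assms in auto)

text \<open>By invariance of domain the injective continuous image of the open set is open. This
  brings the bound on \<open>\<psi>\<close>, known on \<open>interior U\<close>, to bear at images
  of interior points of \<open>V\<close>.\<close>

lemma phi_interior: "\<phi> ` interior V \<subseteq> interior U"
proof (rule interior_maximal)
  have "inj_on \<phi> (interior V)"
    by (rule inj_on_inverseI[of _ \<psi>]) (rule psi_phi[OF subsetD[OF interior_subset]])
  then show "open (\<phi> ` interior V)"
    using continuous_on_subset[OF continuous_on_phi interior_subset]
    by (intro invariance_of_domain) auto
  show "\<phi> ` interior V \<subseteq> U" using \<phi> interior_subset[of V] by blast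
qed

text \<open>The bound for \<open>\<phi>\<close> gives one inequality and the reciprocal bound for
  its inverse gives the other.\<close>

lemma phi_local_similarity:
  assumes p: "p \<in> interior V"
  shows "\<exists>r>0. \<forall>x\<in>ball p r. \<forall>y\<in>ball p r. dist (\<phi> x) (\<phi> y) = 1 / \<bar>c\<bar> * dist x y"
proof -
  have "\<phi> p \<in> interior U" using p phi_interior by auto
  then obtain s where s: "s > 0" "ball (\<phi> p) s \<subseteq> interior U"
    by (meson open_contains_ball open_interior)
  obtain r1 where r1: "r1 > 0" "ball p r1 \<subseteq> V"
    using p mem_interior by blast
  have "isCont \<phi> p"
    using continuous_on_interior[OF continuous_on_phi p] .
  then obtain r2 where r2: "r2 > 0" "\<And>x. dist x p < r2 \<Longrightarrow> dist (\<phi> x) (\<phi> p) < s"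
    using s(1) unfolding continuous_at_eps_delta by blast
  define r where "r = min r1 r2"
  have r: "r > 0" "ball p r \<subseteq> V" "\<And>x. x \<in> ball p r \<Longrightarrow> \<phi> x \<in> ball (\<phi> p) s"
    using r1 r2 by (auto simp: r_def dist_commute subset_iff)
  have 1: "(1 / \<bar>c\<bar>)-lipschitz_on (ball p r) \<phi>"
    using r(2) by (intro pointwise_lipschitz_imp_lipschitz_on)
      (auto simp: subset_iff intro!: pointwise_lipschitz_subset[OF pointwise_lipschitz_phi])
  have 2: "\<bar>c\<bar>-lipschitz_on (ball (\<phi> p) s) \<psi>"
    using s(2) by (intro pointwise_lipschitz_imp_lipschitz_on)
      (auto simp: subset_iff intro!: pointwise_lipschitz_subset[OF pointwise_lipschitz_psi_interior])
  have "dist (\<phi> x) (\<phi> y) = 1 / \<bar>c\<bar> * dist x y" if "x \<in> ball p r" "y \<in> ball p r" for x y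
  proof (rule antisym)
    show "dist (\<phi> x) (\<phi> y) \<le> 1 / \<bar>c\<bar> * dist x y" using 1 that by (rule lipschitz_onD)
    have "dist (\<psi> (\<phi> x)) (\<psi> (\<phi> y)) \<le> \<bar>c\<bar> * dist (\<phi> x) (\<phi> y)"
      using 2 r(3)[OF that(1)] r(3)[OF that(2)] by (rule lipschitz_onD)
    then have "dist x y \<le> \<bar>c\<bar> * dist (\<phi> x) (\<phi> y)"
      using that r(2) psi_phi by (metis subsetD)
    then show "1 / \<bar>c\<bar> * dist x y \<le> dist (\<phi> x) (\<phi> y)"
      using c_nonzero by (simp add: divide_le_eq mult.commute)
  qed
  then show ?thesis using r(1) by blast
qed

end

text \<open>The two topological conditions on \<open>V\<close> are what both geometric cases share:
  connectedness gives one affine formula on the interior, and density extends it to the rest of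
  \<open>V\<close> by continuity.\<close>

lemma lipschitz_constant_preserving_imp_similarity:
  fixes U V :: "(real ^ 'n) set"
  assumes "lipschitz_constant_preserving L U V \<phi> h"
    and V: "connected (interior V)" "V \<subseteq> closure (interior V)"
  shows "\<exists>\<alpha>>0. ((\<forall>v\<in>V. h v = inverse \<alpha>) \<or> (\<forall>v\<in>V. h v = - inverse \<alpha>)) \<and>
           (\<exists>(A :: real ^ 'n ^ 'n) b. orthogonal_matrix A \<and> (\<forall>v\<in>V. \<phi> v = \<alpha> *\<^sub>R (A *v v) + b))"
proof -
  interpret lipschitz_constant_preserving L U V \<phi> h by fact
  define \<alpha> where "\<alpha> = 1 / \<bar>c\<bar>"
  have "\<alpha> > 0" using c_nonzero by (simp add: \<alpha>_def)
  obtain A b where A: "orthogonal_matrix A"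
    and Ab: "\<And>x. x \<in> interior V \<Longrightarrow> \<phi> x = \<alpha> *\<^sub>R (A *v x) + b"
    using local_similarity_imp_affine[OF open_interior V(1) \<open>\<alpha> > 0\<close>] phi_local_similarity
    unfolding \<alpha>_def by metis
  have "\<phi> v - \<alpha> *\<^sub>R (A *v v) = b" if "v \<in> V" for v
  proof -
    have "continuous_on V (\<lambda>v. \<phi> v - \<alpha> *\<^sub>R (A *v v))"
      by (intro continuous_intros continuous_on_phi)
    moreover have "\<phi> x - \<alpha> *\<^sub>R (A *v x) = b" if "x \<in> interior V" for x
      using Ab[OF that] by simp
    ultimately show ?thesis
      using continuous_constant_on_dense[OF _ interior_subset V(2) _ that] by blast
  qed
  then have "\<forall>v\<in>V. \<phi> v = \<alpha> *\<^sub>R (A *v v) + b" by (metis add.commute diff_add_cancel)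
  moreover have "(\<forall>v\<in>V. h v = inverse \<alpha>) \<or> (\<forall>v\<in>V. h v = - inverse \<alpha>)"
    using weight_eq by (cases "c > 0") (auto simp: \<alpha>_def)
  ultimately show ?thesis using A \<open>\<alpha> > 0\<close> by blast
qed

theorem theorem3p6:
  fixes U V :: "(real ^ 'n) set"
    and \<phi> :: "real ^ 'n \<Rightarrow> real ^ 'n"
    and h :: "real ^ 'n \<Rightarrow> real"
  assumes "(open U \<and> connected U \<and> open V \<and> connected V) \<or> (convex_body U \<and> convex_body V)"
    and "\<phi> \<in> V \<rightarrow> U"
    and "(bij_betw (weighted_comp V h \<phi>) (Lip_loc U) (Lip_loc V) \<and>
            preserves_local_constants U V \<phi> (weighted_comp V h \<phi>)) \<or>
         (bij_betw (weighted_comp V h \<phi>) (Lip_pt U) (Lip_pt V) \<and>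
            preserves_pointwise_constants U V \<phi> (weighted_comp V h \<phi>))"
  shows "\<exists>\<alpha>>0. ((\<forall>v\<in>V. h v = inverse \<alpha>) \<or> (\<forall>v\<in>V. h v = - inverse \<alpha>)) \<and>
           (\<exists>(A :: real ^ 'n ^ 'n) b. orthogonal_matrix A \<and> (\<forall>v\<in>V. \<phi> v = \<alpha> *\<^sub>R (A *v v) + b))"
proof (cases "V = {}")
  case True
  \<comment> \<open>All claims about points of \<open>V\<close> are vacuous, so
    \<open>\<alpha> = 1\<close> and the identity matrix serve.\<close>
  then show ?thesis
    using orthogonal_matrix_id by (intro exI[of _ 1]) auto
next
  case False
  have V: "open V \<and> connected V \<or> convex V"
    using assms(1) by (auto simp: convex_body_def)
  have "connected (interior V) \<and> V \<subseteq> closure (interior V)"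
    using assms(1)
  proof
    assume "convex_body U \<and> convex_body V"
    then show ?thesis
      using convex_closure_interior[of V] closure_subset[of V]
      by (auto simp: convex_body_def intro: convex_connected convex_interior)
  qed (auto simp: interior_open closure_subset)
  moreover have "\<exists>L. lipschitz_constant_preserving L U V \<phi> h"
    using assms(3)
  proof
    assume "bij_betw (weighted_comp V h \<phi>) (Lip_loc U) (Lip_loc V) \<and>
      preserves_local_constants U V \<phi> (weighted_comp V h \<phi>)"
    then have "lipschitz_constant_preserving L_loc U V \<phi> h"
      using False V assms(2)
      by unfold_locales
        (auto simp: Lip_loc_def preserves_local_constants_def L_pt_le_L_loc L_loc_le_lipschitz)
    then show ?thesis by blast
  next
    assume "bij_betw (weighted_comp V h \<phi>) (Lip_pt U) (Lip_pt V) \<and>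
      preserves_pointwise_constants U V \<phi> (weighted_comp V h \<phi>)"
    then have "lipschitz_constant_preserving L_pt U V \<phi> h"
      using False V assms(2)
      by unfold_locales
        (auto simp: Lip_pt_def preserves_pointwise_constants_def
          intro: order_trans[OF L_pt_le_L_loc L_loc_le_lipschitz])
    then show ?thesis by blast
  qed
  ultimately show ?thesis using lipschitz_constant_preserving_imp_similarity by blast
qed

end
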